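(* Let $k\in\mathbb N$ with $k\le|\mathsf V|$ and $p\in[1,\infty]$. Let $\mathsf G=(\mathsf V,\mathsf E,\nu,\omega)$ be a weighted graph with $\nu(\mathsf V)<\infty$ such that: (i) there exists $C>0$ such that for all $\mathsf V_0\subset\mathsf V$ that induce a connected subgraph and all $f\in D(\mathcal Q^{\mathrm B}_{\mathsf V_0})$ with $\sum_{\mathsf v\in\mathsf V_0}\nu(\mathsf v)f(\mathsf v)=0$ one has $\|f\|_{\ell^\infty(\mathsf V_0)}\le C\,\mathcal Q^{\mathrm B}_{\mathsf V_0}(f)^{1/2}$; (ii) for any two vertices $\mathsf v\ne\mathsf w$ in $\mathsf V$ there are only finitely many non-contractible paths in $\mathsf G$ connecting $\mathsf v$ and $\mathsf w$. Then there exists a $k$-partition $\mathcal P\in\mathfrak C_k(\mathsf G)$ with $$\mathfrak L^{\mathrm B}_{k,p}(\mathsf G)=\Lambda^{\mathrm B}_{k,p}(\mathcal P).$$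
   Context: Graph setting: $\mathsf G$ is a finite or countably infinite, simple, connected graph with vertex weights $\nu:\mathsf V\to(0,\infty)$ and edge weights $\omega:\mathsf E\to(0,\infty)$, with $\sum_{\mathsf e\ni\mathsf v}\omega(\mathsf e)<\infty$ for every $\mathsf v$; $\nu(\mathsf S)=\sum_{\mathsf v\in\mathsf S}\nu(\mathsf v)$. For $\mathsf V_0\subset\mathsf V$, $\ell^2_\nu(\mathsf V_0)$ has norm $\|g\|^2=\sum_{\mathsf v\in\mathsf V_0}\nu(\mathsf v)|g(\mathsf v)|^2$. Boundaryless form: for nonempty $\mathsf V_0\subset\mathsf V$ (including $\mathsf V_0=\mathsf V$), let $\mathsf E_0$ be the set of edges with both endpoints in $\mathsf V_0$, $\mathcal Q^{\mathrm B}_{\mathsf V_0}(g)=\sum_{\mathsf e=\{\mathsf v,\mathsf w\}\in\mathsf E_0}\omega(\mathsf e)|g(\mathsf v)-g(\mathsf w)|^2$ and $D(\mathcal Q^{\mathrm B}_{\mathsf V_0})=\{g\in\ell^2_\nu(\mathsf V_0):\mathcal Q^{\mathrm B}_{\mathsf V_0}(g)<\infty\}$. The boundaryless energy is $$\lambda_2^{\mathrm B}(\mathsf V_0)=\min\left\{\frac{\mathcal Q^{\mathrm B}_{\mathsf V_0}(g)}{\|g\|^2_{\ell^2_\nu(\mathsf V_0)}}: g\in D(\mathcal Q^{\mathrm B}_{\mathsf V_0})\setminus\{0\},\ \sum_{\mathsf v\in\mathsf V_0}\nu(\mathsf v)g(\mathsf v)=0\right\},$$ with $\lambda_2^{\mathrm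 B}(\mathsf V_0)=\infty$ if $|\mathsf V_0|=1$. Paths: a path between $\mathsf v$ and $\mathsf w$ is a finite sequence of pairwise distinct vertices starting at $\mathsf v$ and ending at $\mathsf w$ with consecutive vertices adjacent in $\mathsf G$. It is non-contractible if any two of its vertices that are adjacent in $\mathsf G$ are consecutive in the path. Partitions: a $k$-partition $\mathcal P=(\mathsf V_j)_{1\le j\le k}$ is a family of nonempty, pairwise disjoint subsets of $\mathsf V$ with union $\mathsf V$; $\mathfrak C_k(\mathsf G)$ is the set of those for which each $\mathsf V_j$ induces a connected subgraph. $\Lambda^{\mathrm B}_{k,p}(\mathcal P)=\bigl(\frac1k\sum_{j=1}^k\lambda_2^{\mathrm B}(\mathsf V_j)^p\bigr)^{1/p}$ for $1\le p<\infty$, $\Lambda^{\mathrm B}_{k,\infty}(\mathcal P)=\max_j\lambda_2^{\mathrm B}(\mathsf V_j)$, and $\mathfrak L^{\mathrm B}_{k,p}(\mathsf G)=\inf_{\mathcal P\in\mathfrak C_k(\mathsf G)}\Lambda^{\mathrm B}_{k,p}(\mathcal P)$ (values in $[0,\infty]$). *)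

theory Defs
  imports "HOL-Analysis.Analysis"
begin

text \<open>
  An edge is a two-element set of vertices. Infinite sums of nonnegative quantities are taken
  in \<^typ>\<open>ennreal\<close>, so that they always converge, possibly to infinity.
\<close>

definition is_path :: "'a set \<Rightarrow> 'a set set \<Rightarrow> 'a \<Rightarrow> 'a \<Rightarrow> 'a list \<Rightarrow> bool" where
  "is_path V E v w xs \<longleftrightarrow>
     xs \<noteq> [] \<and> hd xs = v \<and> last xs = w \<and> set xs \<subseteq> V \<and> distinct xs \<and>
     successively (\<lambda>x y. {x, y} \<in> E) xs"

definition non_contractible :: "'a set set \<Rightarrow> 'a list \<Rightarrow> bool" where
  "non_contractible E xs \<longleftrightarrow>
     (\<forall>i<length xs. \<forall>j<length xs. {xs ! i, xs ! j} \<in> E \<longrightarrow> j = Suc i \<or> i = Suc j)"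

definition induced_edges :: "'a set set \<Rightarrow> 'a set \<Rightarrow> 'a set set" where
  "induced_edges E V0 = {e \<in> E. e \<subseteq> V0}"

definition induces_connected :: "'a set set \<Rightarrow> 'a set \<Rightarrow> bool" where
  "induces_connected E V0 \<longleftrightarrow>
     V0 \<noteq> {} \<and> (\<forall>v\<in>V0. \<forall>w\<in>V0. \<exists>xs. is_path V0 (induced_edges E V0) v w xs)"

locale weighted_graph =
  fixes V :: "'a set" and E :: "'a set set" and \<nu> :: "'a \<Rightarrow> real" and \<omega> :: "'a set \<Rightarrow> real"
  assumes countable_vertices: "countable V"
    and simple: "e \<in> E \<Longrightarrow> e \<subseteq> V \<and> card e = 2"
    and connected: "induces_connected E V"
    and vertex_weight_pos: "v \<in> V \<Longrightarrow> \<nu> v > 0"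
    and edge_weight_pos: "e \<in> E \<Longrightarrow> \<omega> e > 0"
    and edge_weights_summable: "v \<in> V \<Longrightarrow> \<omega> summable_on {e \<in> E. v \<in> e}"

definition vertex_measure :: "('a \<Rightarrow> real) \<Rightarrow> 'a set \<Rightarrow> ennreal" where
  "vertex_measure \<nu> S = (\<Sum>\<^sub>\<infinity>v\<in>S. ennreal (\<nu> v))"

text \<open>
  A function on \<open>V0\<close> is represented by a function on the whole vertex type, of which only the
  values on \<open>V0\<close> are ever used.
\<close>

definition l2_norm_sq :: "('a \<Rightarrow> real) \<Rightarrow> 'a set \<Rightarrow> ('a \<Rightarrow> real) \<Rightarrow> ennreal" where
  "l2_norm_sq \<nu> V0 g = (\<Sum>\<^sub>\<infinity>v\<in>V0. ennreal (\<nu> v * \<bar>g v\<bar>\<^sup>2))"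

definition linf_norm :: "'a set \<Rightarrow> ('a \<Rightarrow> real) \<Rightarrow> ennreal" where
  "linf_norm V0 g = (SUP v\<in>V0. ennreal \<bar>g v\<bar>)"

text \<open>The mean is taken with \<open>has_sum\<close> because \<open>infsum\<close> is 0 for divergent sums.\<close>

definition mean_zero :: "('a \<Rightarrow> real) \<Rightarrow> 'a set \<Rightarrow> ('a \<Rightarrow> real) \<Rightarrow> bool" where
  "mean_zero \<nu> V0 g \<longleftrightarrow> ((\<lambda>v. \<nu> v * g v) has_sum 0) V0"

text \<open>Well defined because the difference is symmetric in the two endpoints, see below.\<close>

definition edge_diff :: "('a \<Rightarrow> real) \<Rightarrow> 'a set \<Rightarrow> real" where
  "edge_diff g e = (THE d. \<exists>v w. e = {v, w} \<and> d = \<bar>g v - g w\<bar>)"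

lemma edge_diff_pair: "edge_diff g {v, w} = \<bar>g v - g w\<bar>"
  unfolding edge_diff_def by (rule the_equality) (auto simp: doubleton_eq_iff)

definition QB :: "'a set set \<Rightarrow> ('a set \<Rightarrow> real) \<Rightarrow> 'a set \<Rightarrow> ('a \<Rightarrow> real) \<Rightarrow> ennreal" where
  "QB E \<omega> V0 g = (\<Sum>\<^sub>\<infinity>e\<in>induced_edges E V0. ennreal (\<omega> e * (edge_diff g e)\<^sup>2))"

definition domQB ::
  "'a set set \<Rightarrow> ('a \<Rightarrow> real) \<Rightarrow> ('a set \<Rightarrow> real) \<Rightarrow> 'a set \<Rightarrow> ('a \<Rightarrow> real) set" where
  "domQB E \<nu> \<omega> V0 = {g. l2_norm_sq \<nu> V0 g < \<infinity> \<and> QB E \<omega> V0 g < \<infinity>}"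

text \<open>
  The minimum is rendered as an infimum, which agrees with it whenever it is attained and is
  defined in general. A nonzero \<open>g\<close> is one that does not vanish identically on \<open>V0\<close>.
\<close>

definition lambda2B ::
  "'a set set \<Rightarrow> ('a \<Rightarrow> real) \<Rightarrow> ('a set \<Rightarrow> real) \<Rightarrow> 'a set \<Rightarrow> ennreal" where
  "lambda2B E \<nu> \<omega> V0 =
     (if is_singleton V0 then \<infinity>
      else INF g\<in>{g \<in> domQB E \<nu> \<omega> V0. (\<exists>v\<in>V0. g v \<noteq> 0) \<and> mean_zero \<nu> V0 g}.
             QB E \<omega> V0 g / l2_norm_sq \<nu> V0 g)"

text \<open>
  A \<open>k\<close>-partition is a family indexed by \<open>{1..k}\<close>; its values at other indices are irrelevant.
\<close>

definition k_partition :: "'a set \<Rightarrow> nat \<Rightarrow> (nat \<Rightarrow> 'a set) \<Rightarrow> bool" where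
  "k_partition V k P \<longleftrightarrow>
     (\<forall>j\<in>{1..k}. P j \<noteq> {}) \<and> disjoint_family_on P {1..k} \<and> (\<Union>j\<in>{1..k}. P j) = V"

definition connected_partitions ::
  "'a set \<Rightarrow> 'a set set \<Rightarrow> nat \<Rightarrow> (nat \<Rightarrow> 'a set) set" where
  "connected_partitions V E k =
     {P. k_partition V k P \<and> (\<forall>j\<in>{1..k}. induces_connected E (P j))}"

text \<open>Powers of extended nonnegative reals, for exponents \<open>r > 0\<close>.\<close>

definition ennpowr :: "ennreal \<Rightarrow> real \<Rightarrow> ennreal" where
  "ennpowr x r = (if x = \<infinity> then \<infinity> else ennreal (enn2real x powr r))"

definition partition_energy ::
  "'a set set \<Rightarrow> ('a \<Rightarrow> real) \<Rightarrow> ('a set \<Rightarrow> real) \<Rightarrow> nat \<Rightarrow> ennreal \<Rightarrow> (nat \<Rightarrow> 'a set) \<Rightarrow> ennreal"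
  where
  "partition_energy E \<nu> \<omega> k p P =
     (if p = \<infinity> then Max ((\<lambda>j. lambda2B E \<nu> \<omega> (P j)) ` {1..k})
      else ennpowr ((\<Sum>j=1..k. ennpowr (lambda2B E \<nu> \<omega> (P j)) (enn2real p)) / of_nat k)
             (1 / enn2real p))"

definition minimal_energy ::
  "'a set \<Rightarrow> 'a set set \<Rightarrow> ('a \<Rightarrow> real) \<Rightarrow> ('a set \<Rightarrow> real) \<Rightarrow> nat \<Rightarrow> ennreal \<Rightarrow> ennreal" where
  "minimal_energy V E \<nu> \<omega> k p =
     (INF P\<in>connected_partitions V E k. partition_energy E \<nu> \<omega> k p P)"

end

theory Submission
  imports Defs "HOL-Complex_Analysis.Great_Picard"
begin

text \<open>
  Take a minimizing sequence of connected partitions. Since the vertex set is countable, a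
  diagonal subsequence settles the membership of every vertex in every cell, which yields limit
  cells. They are connected because two vertices of a cell are joined inside the cell by a
  shortest path, and only finitely many paths are candidates. Normalized test functions for the
  converging cells are uniformly bounded by the Sobolev-type hypothesis; as the total measure is
  finite, their norm and mean pass to a pointwise limit by dominated convergence, while the form
  can only drop. Hence no limit cell is empty and the energy is lower semicontinuous.
\<close>

subsection \<open>Connected vertex sets\<close>

text \<open>Pointwise convergence of cells preserves neither nonemptiness nor connectedness: a cell
  may run off to infinity, and so may the paths that join two of its vertices. The uniform bound on
  test functions guards against the first loss, the finiteness of the candidate paths against the
  second. The minimizing sequence controls only a mean of the energies. Each single energy is at
  most \<open>k\<close> times that mean, so the energies stay finite and can be made to converge
  along with the cells. When the infimum is infinite there is nothing to minimize, but some
  connected partition still has to exist; the splitting of connected sets serves this case. No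
  minimizer of the quotient defining \<open>lambda2B\<close> is ever used. Competitors whose error
  tends to zero are enough, since their pointwise limit is a competitor for the limit cell.\<close>

definition adj :: "'a set set \<Rightarrow> 'a set \<Rightarrow> ('a \<times> 'a) set" where
  "adj E S = {(x, y). x \<in> S \<and> y \<in> S \<and> {x, y} \<in> E}"

lemma sym_adj: "sym (adj E S)"
  by (auto simp: sym_def adj_def insert_commute)

lemma is_path_imp_rtrancl:
  assumes "is_path S (induced_edges E S) v w xs"
  shows "(v, w) \<in> (adj E S)\<^sup>*"
proof -
  have "successively (\<lambda>x y. {x, y} \<in> induced_edges E S) xs \<Longrightarrow> xs \<noteq> [] \<Longrightarrow>
      (hd xs, last xs) \<in> (adj E S)\<^sup>*" for xs
  proof (induction xs rule: induct_list012)
    case (3 x y zs)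
    have "(x, y) \<in> adj E S"
      using 3 by (auto simp: adj_def induced_edges_def)
    with 3 show ?case
      by (auto intro: converse_rtrancl_into_rtrancl)
  qed auto
  with assms show ?thesis
    unfolding is_path_def by blast
qed

text \<open>Loop erasure: when the walk returns to a vertex that is already on the path, the path is
  cut back to that vertex, which keeps its vertices distinct.\<close>

lemma rtrancl_imp_is_path:
  assumes "(v, w) \<in> (adj E S)\<^sup>*" "v \<in> S"
  shows "\<exists>xs. is_path S (induced_edges E S) v w xs"
  using assms(1)
proof induction
  case base
  have "is_path S (induced_edges E S) v v [v]"
    using assms(2) by (simp add: is_path_def)
  then show ?case ..
next
  case (step y z)
  then obtain xs where xs: "is_path S (induced_edges E S) v y xs" by blast
  show ?case
  proof (cases "z \<in> set xs")
    case True
    then obtain as bs where "xs = as @ z # bs" by (meson split_list)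
    with xs have "is_path S (induced_edges E S) v z (as @ [z])"
      by (auto simp: is_path_def successively_append_iff hd_append)
    then show ?thesis ..
  next
    case False
    have "is_path S (induced_edges E S) v z (xs @ [z])"
      using xs False step(2)
      by (auto simp: is_path_def successively_append_iff adj_def induced_edges_def)
    then show ?thesis ..
  qed
qed

text \<open>Walks replace paths here: they can be concatenated and extended without regard to
  repeated vertices, so connectedness proofs become inductions on the closure.\<close>

lemma induces_connected_iff:
  "induces_connected E S \<longleftrightarrow> S \<noteq> {} \<and> (\<forall>v\<in>S. \<forall>w\<in>S. (v, w) \<in> (adj E S)\<^sup>*)"
  unfolding induces_connected_def
  using is_path_imp_rtrancl rtrancl_imp_is_path by metis

lemma induces_connectedI:
  assumes "v \<in> S" "\<And>x. x \<in> S \<Longrightarrow> (v, x) \<in> (adj E S)\<^sup>*"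
  shows "induces_connected E S"
proof -
  have "(x, y) \<in> (adj E S)\<^sup>*" if "x \<in> S" "y \<in> S" for x y
  proof (rule rtrancl_trans)
    show "(x, v) \<in> (adj E S)\<^sup>*"
      using sym_rtrancl[OF sym_adj] assms(2)[OF that(1)] by (rule symD)
  qed (rule assms(2)[OF that(2)])
  with assms(1) show ?thesis by (auto simp: induces_connected_iff)
qed

text \<open>One part is a component of what remains of the set after removing a vertex.\<close>

lemma split_connected:
  assumes conn: "induces_connected E S" and "v \<in> S" "w \<in> S" "v \<noteq> w"
  obtains A where "A \<subseteq> S" "induces_connected E A" "induces_connected E (S - A)"
proof -
  define A where "A = {x. (w, x) \<in> (adj E (S - {v}))\<^sup>*}"
  have wA: "w \<in> A" by (simp add: A_def)
  have sub: "A \<subseteq> S - {v}"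
  proof
    fix x assume "x \<in> A"
    then have "(w, x) \<in> (adj E (S - {v}))\<^sup>*" by (simp add: A_def)
    then show "x \<in> S - {v}"
      using assms by (induction) (auto simp: adj_def)
  qed
  have A_step: "z \<in> A" if "y \<in> A" "(y, z) \<in> adj E (S - {v})" for y z
    using that by (auto simp: A_def intro: rtrancl_into_rtrancl)
  have wx: "(w, x) \<in> (adj E A)\<^sup>*" if "x \<in> A" for x
  proof -
    have "(w, x) \<in> (adj E (S - {v}))\<^sup>*" using that by (simp add: A_def)
    then have "(w, x) \<in> (adj E A)\<^sup>* \<and> x \<in> A"
    proof induction
      case base then show ?case using wA by simp
    next
      case (step y z)
      then have "z \<in> A" using A_step by blast
      then have "(y, z) \<in> adj E A" using step by (auto simp: adj_def)
      then show ?case using step \<open>z \<in> A\<close> by (auto intro: rtrancl_into_rtrancl)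
    qed
    then show ?thesis ..
  qed
  have "induces_connected E A" using wA wx by (rule induces_connectedI)
  moreover
  have vu: "(v, u) \<in> (adj E (S - A))\<^sup>*" if "u \<in> S - A" for u
  proof -
    have "(v, u) \<in> (adj E S)\<^sup>*"
      using conn that \<open>v \<in> S\<close> by (auto simp: induces_connected_iff)
    \<comment> \<open>A walk in \<open>S\<close> can leave \<open>A\<close> only into
      \<open>v\<close>, because \<open>A\<close> is a whole component of \<open>S - {v}\<close>. So
      if a walk from \<open>v\<close> ends outside \<open>A\<close>, its part after the last visit
      to \<open>v\<close> avoids \<open>A\<close>.\<close>
    then have "u \<in> A \<or> (v, u) \<in> (adj E (S - A))\<^sup>*"
    proof induction
      case (step y z)
      have yz: "y \<in> S" "z \<in> S" "{y, z} \<in> E" using step(2) by (auto simp: adj_def)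
      show ?case
      proof (cases "z \<in> A \<or> z = v")
        case False
        have "y \<notin> A"
        proof
          assume "y \<in> A"
          then have "(y, z) \<in> adj E (S - {v})" using yz False sub by (auto simp: adj_def)
          then show False using A_step \<open>y \<in> A\<close> False by blast
        qed
        moreover have "(y, z) \<in> adj E (S - A)" using yz False \<open>y \<notin> A\<close> by (auto simp: adj_def)
        ultimately show ?thesis using step.IH by (auto intro: rtrancl_into_rtrancl)
      qed auto
    qed simp
    with that show ?thesis by simp
  qed
  have "induces_connected E (S - A)"
    using \<open>v \<in> S\<close> sub vu by (intro induces_connectedI[of v]) auto
  ultimately show thesis using that sub by blast
qed

text \<open>By pigeonhole, \<open>k\<close> cells covering more than \<open>k\<close> vertices
  include one with two vertices, and splitting that cell into two connected parts gives
  \<open>Suc k\<close> cells.\<close>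

lemma connected_partitions_nonempty:
  assumes conn: "induces_connected E V" and "1 \<le> k" "finite V \<longrightarrow> k \<le> card V"
  shows "connected_partitions V E k \<noteq> {}"
  using assms(2,3)
proof (induction k rule: nat_induct_at_least)
  case base
  have "(\<lambda>_. V) \<in> connected_partitions V E 1"
    using conn by (auto simp: connected_partitions_def k_partition_def
        induces_connected_def disjoint_family_on_def)
  then show ?case by blast
next
  case (Suc k)
  then obtain P where P: "P \<in> connected_partitions V E k" by fastforce
  then have ne: "\<And>j. j \<in> {1..k} \<Longrightarrow> P j \<noteq> {}"
    and disj: "disjoint_family_on P {1..k}" and un: "(\<Union>j\<in>{1..k}. P j) = V"
    and con: "\<And>j. j \<in> {1..k} \<Longrightarrow> induces_connected E (P j)"
    by (auto simp: connected_partitions_def k_partition_def)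
  have "\<exists>j\<in>{1..k}. \<not> is_singleton (P j)"
  proof (rule ccontr)
    assume all_single: "\<not> ?thesis"
    have single: "card (P j) = 1 \<and> finite (P j)" if "j \<in> {1..k}" for j
    proof -
      have "is_singleton (P j)" using that all_single by blast
      then show ?thesis by (auto simp: is_singleton_def)
    qed
    have "card V \<le> (\<Sum>j\<in>{1..k}. card (P j))"
      unfolding un[symmetric] by (rule card_UN_le) simp
    also have "\<dots> = k" using single by simp
    finally have "card V \<le> k" .
    moreover have "finite V" using un single by auto
    ultimately show False using Suc by simp
  qed
  then obtain j where j: "j \<in> {1..k}" "\<not> is_singleton (P j)" by blast
  then obtain v w where vw: "v \<in> P j" "w \<in> P j" "v \<noteq> w"
    using ne by (metis is_singletonI' )
  obtain A where A: "A \<subseteq> P j" "induces_connected E A" "induces_connected E (P j - A)"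
    by (rule split_connected[OF con[OF j(1)] vw])
  define Q where "Q = P(j := A, Suc k := P j - A)"
  have Qj: "Q i = (if i = Suc k then P j - A else if i = j then A else P i)" for i
    by (simp add: Q_def)
  have iv: "{1..Suc k} = insert (Suc k) {1..k}" by auto
  have "induces_connected E (Q i)" if "i \<in> {1..Suc k}" for i
    using that A con by (auto simp: Qj iv)
  moreover from this have "Q i \<noteq> {}" if "i \<in> {1..Suc k}" for i
    using that by (simp add: induces_connected_def)
  moreover have "disjoint_family_on Q {1..Suc k}"
  proof -
    have sub: "Q i \<subseteq> P i" if "i \<noteq> Suc k" for i using that A(1) by (auto simp: Qj)
    have "Q i \<inter> Q i' = {}" if "i \<in> {1..k}" "i' \<in> {1..k}" "i \<noteq> i'" for i i'
      using disjoint_family_onD[OF disj that] sub[of i] sub[of i'] that by auto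
    moreover have last: "Q i \<inter> Q (Suc k) = {}" if "i \<in> {1..k}" for i
    proof (cases "i = j")
      case False
      have "P i \<inter> P j = {}" using disjoint_family_onD[OF disj that j(1) False] .
      then show ?thesis using that False by (auto simp: Qj)
    qed (use that in \<open>auto simp: Qj\<close>)
    ultimately show ?thesis
      unfolding iv disjoint_family_on_def by (auto simp: Int_commute[of "Q (Suc k)"])
  qed
  moreover have "(\<Union>i\<in>{1..Suc k}. Q i) = V"
  proof -
    have ivj: "{1..Suc k} = insert (Suc k) (insert j ({1..k} - {j}))" using j(1) by auto
    have "(\<Union>i\<in>{1..k} - {j}. Q i) = (\<Union>i\<in>{1..k} - {j}. P i)"
      by (rule SUP_cong) (auto simp: Qj)
    then have "(\<Union>i\<in>{1..Suc k}. Q i) = Q (Suc k) \<union> Q j \<union> (\<Union>i\<in>{1..k} - {j}. P i)"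
      unfolding ivj by (simp only: UN_insert Un_assoc)
    also have "\<dots> = (P j - A) \<union> A \<union> (\<Union>i\<in>{1..k} - {j}. P i)" using j(1) by (simp add: Qj)
    also have "\<dots> = P j \<union> (\<Union>i\<in>{1..k} - {j}. P i)" using A(1) by blast
    also have "\<dots> = V" using un j(1) by blast
    finally show ?thesis .
  qed
  ultimately have "Q \<in> connected_partitions V E (Suc k)"
    by (auto simp: connected_partitions_def k_partition_def)
  then show ?case by blast
qed

text \<open>A shortest path is non-contractible, since a chord would shorten it.\<close>

lemma connected_imp_non_contractible_path:
  assumes no_loops: "\<And>x. {x} \<notin> E"
    and conn: "induces_connected E S" and vw: "v \<in> S" "w \<in> S"
  obtains xs where "is_path S (induced_edges E S) v w xs" "non_contractible E xs"
proof -
  let ?P = "is_path S (induced_edges E S) v w"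
  have "\<exists>xs. ?P xs" using conn vw by (auto simp: induces_connected_def)
  then obtain xs where xs: "?P xs" and least: "\<And>ys. ?P ys \<Longrightarrow> length xs \<le> length ys"
    using ex_has_least_nat[of ?P _ length] by metis
  have no_chord: "\<not> Suc i < j" if ij: "j < length xs" "{xs ! i, xs ! j} \<in> E" for i j
  proof
    assume less: "Suc i < j"
    let ?ys = "take (Suc i) xs @ drop j xs"
    have succ: "successively (\<lambda>x y. {x, y} \<in> induced_edges E S) (take m xs)"
      "successively (\<lambda>x y. {x, y} \<in> induced_edges E S) (drop m xs)" for m
      using xs successively_append_iff[of _ "take m xs" "drop m xs"] by (auto simp: is_path_def)
    have "last (take (Suc i) xs) = xs ! i"
      using less ij by (simp add: take_Suc_conv_app_nth)
    moreover have "hd (drop j xs) = xs ! j" using ij by (simp add: hd_drop_conv_nth)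
    \<comment> \<open>A chord is an arbitrary edge of \<open>E\<close>, but both its ends lie on the
      path and hence in \<open>S\<close>. This is why a path that is shortest within
      \<open>S\<close> is non-contractible in the whole graph.\<close>
    moreover have "{xs ! i, xs ! j} \<in> induced_edges E S"
      using ij less xs nth_mem[of i xs] nth_mem[of j xs] by (auto simp: induced_edges_def is_path_def)
    ultimately have "successively (\<lambda>x y. {x, y} \<in> induced_edges E S) ?ys"
      using succ by (simp add: successively_append_iff)
    moreover have "distinct ?ys"
      using xs less set_take_disj_set_drop_if_distinct[of xs "Suc i" j] by (simp add: is_path_def)
    moreover have "set ?ys \<subseteq> S"
      using xs by (auto simp: is_path_def dest: in_set_takeD in_set_dropD)
    ultimately have "?P ?ys"
      using xs ij less by (auto simp: is_path_def hd_append)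
    then have "length xs \<le> length ?ys" by (rule least)
    then show False using less ij by simp
  qed
  have "non_contractible E xs"
    unfolding non_contractible_def
  proof (intro allI impI)
    fix i j assume ij: "i < length xs" "j < length xs" "{xs ! i, xs ! j} \<in> E"
    then have "\<not> Suc i < j" "\<not> Suc j < i" using no_chord by (auto simp: insert_commute)
    moreover have "i \<noteq> j" using ij no_loops by auto
    ultimately show "j = Suc i \<or> i = Suc j" by linarith
  qed
  with xs that show thesis by blast
qed

text \<open>\<open>T\<close> has to contain only the vertices of the path, not \<open>S\<close>. A
  path found in an approximating cell can thus be moved to the limit cell.\<close>

lemma is_path_mono:
  assumes "is_path S (induced_edges E S) v w xs" "set xs \<subseteq> T"
  shows "is_path T (induced_edges E T) v w xs"
proof -
  have "{x, y} \<in> induced_edges E T"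
    if "x \<in> set xs" "y \<in> set xs" "{x, y} \<in> induced_edges E S" for x y
    using that assms(2) by (auto simp: induced_edges_def)
  then show ?thesis
    using assms unfolding is_path_def by (blast intro: successively_mono)
qed

lemma induces_connected_limit:
  assumes no_loops: "\<And>x. {x} \<notin> E"
    and paths: "\<And>v w. v \<in> V \<Longrightarrow> w \<in> V \<Longrightarrow> v \<noteq> w \<Longrightarrow>
      finite {xs. is_path V E v w xs \<and> non_contractible E xs}"
    and T: "\<And>n. T n \<subseteq> V" "\<And>n. induces_connected E (T n)"
    and S: "S \<subseteq> V" "S \<noteq> {}"
    and lim: "\<And>v. v \<in> V \<Longrightarrow> \<forall>\<^sub>F n in sequentially. v \<in> T n \<longleftrightarrow> v \<in> S"
  shows "induces_connected E S"
  unfolding induces_connected_def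
proof (intro conjI ballI S)
  fix v w assume vw: "v \<in> S" "w \<in> S"
  show "\<exists>xs. is_path S (induced_edges E S) v w xs"
  proof (cases "v = w")
    case True
    then have "is_path S (induced_edges E S) v w [v]" using vw by (simp add: is_path_def)
    then show ?thesis ..
  next
    case False
    \<comment> \<open>All vertices of all candidate paths. Membership converges only vertex by
      vertex, but \<open>U\<close> is finite, so a single index \<open>n\<close> settles it on every
      candidate path at once.\<close>
    define U where "U = (\<Union>xs\<in>{xs. is_path V E v w xs \<and> non_contractible E xs}. set xs)"
    have "finite U" using paths[of v w] False vw S by (auto simp: U_def)
    moreover have "U \<subseteq> V" by (auto simp: U_def is_path_def)
    ultimately have "\<forall>\<^sub>F n in sequentially. \<forall>u\<in>U. u \<in> T n \<longleftrightarrow> u \<in> S"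
      using lim by (auto simp: eventually_ball_finite_distrib)
    moreover have "\<forall>\<^sub>F n in sequentially. v \<in> T n" "\<forall>\<^sub>F n in sequentially. w \<in> T n"
      using lim[of v] lim[of w] vw S by auto
    ultimately have "\<forall>\<^sub>F n in sequentially. (\<forall>u\<in>U. u \<in> T n \<longleftrightarrow> u \<in> S) \<and> v \<in> T n \<and> w \<in> T n"
      by eventually_elim simp
    then obtain n where n: "\<forall>u\<in>U. u \<in> T n \<longleftrightarrow> u \<in> S" "v \<in> T n" "w \<in> T n"
      by (auto simp: eventually_sequentially)
    obtain xs where xs: "is_path (T n) (induced_edges E (T n)) v w xs" "non_contractible E xs"
      by (rule connected_imp_non_contractible_path[OF no_loops T(2) n(2,3)])
    have "successively (\<lambda>x y. {x, y} \<in> E) xs"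
      using xs(1) unfolding is_path_def induced_edges_def by (auto intro: successively_mono)
    then have "is_path V E v w xs" using xs(1) T(1)[of n] by (auto simp: is_path_def)
    then have "set xs \<subseteq> U" using xs(2) by (auto simp: U_def)
    moreover have "set xs \<subseteq> T n" using xs(1) by (simp add: is_path_def)
    ultimately have "set xs \<subseteq> S" using n(1) by blast
    then show ?thesis using is_path_mono[OF xs(1)] by blast
  qed
qed

subsection \<open>Lower semicontinuity of the boundaryless energy\<close>

lemma has_sum_ennreal_iff:
  assumes "\<And>x. x \<in> A \<Longrightarrow> 0 \<le> f x" "0 \<le> c"
  shows "((\<lambda>x. ennreal (f x)) has_sum ennreal c) A \<longleftrightarrow> (f has_sum c) A"
proof -
  have "((\<lambda>F. \<Sum>x\<in>F. ennreal (f x)) \<longlongrightarrow> ennreal c) (finite_subsets_at_top A) \<longleftrightarrow>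
      ((\<lambda>F. ennreal (sum f F)) \<longlongrightarrow> ennreal c) (finite_subsets_at_top A)"
    by (rule tendsto_cong) (auto intro!: eventually_finite_subsets_at_top_weakI sum_ennreal assms)
  also have "\<dots> \<longleftrightarrow> (sum f \<longlongrightarrow> c) (finite_subsets_at_top A)"
    by (rule tendsto_ennreal_iff)
      (auto intro!: eventually_finite_subsets_at_top_weakI sum_nonneg assms)
  finally show ?thesis by (simp add: has_sum_def)
qed

text \<open>Norm and form are defined by sums in \<open>ennreal\<close>, whereas scaling and limits
  are handled over the reals. The real side is stated with \<open>has_sum\<close>, so that a
  divergent family cannot pass for one with sum 0.\<close>

lemma infsum_ennreal_eq_iff:
  assumes "\<And>x. x \<in> A \<Longrightarrow> 0 \<le> f x" "0 \<le> c"
  shows "(\<Sum>\<^sub>\<infinity>x\<in>A. ennreal (f x)) = ennreal c \<longleftrightarrow> (f has_sum c) A"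
proof -
  have "(\<Sum>\<^sub>\<infinity>x\<in>A. ennreal (f x)) = ennreal c \<longleftrightarrow> ((\<lambda>x. ennreal (f x)) has_sum ennreal c) A"
    by (simp add: has_sum_iff nonneg_summable_on_complete)
  also have "\<dots> \<longleftrightarrow> (f has_sum c) A" by (rule has_sum_ennreal_iff) (fact assms)+
  finally show ?thesis .
qed

text \<open>For real families unordered summability is absolute, so these sums are integrals against
  the counting measure on \<open>A\<close>, and Lebesgue's theorem applies.\<close>

lemma has_sum_dominated_convergence:
  fixes f :: "nat \<Rightarrow> 'a \<Rightarrow> real"
  assumes lim: "\<And>x. x \<in> A \<Longrightarrow> (\<lambda>n. f n x) \<longlonglongrightarrow> g x"
    and bound: "\<And>n x. x \<in> A \<Longrightarrow> \<bar>f n x\<bar> \<le> M x" and M: "M summable_on A"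
    and sums: "\<And>n. (f n has_sum s n) A" and s: "s \<longlonglongrightarrow> l"
  shows "(g has_sum l) A"
proof -
  let ?m = "count_space A"
  have "(\<lambda>x. norm (M x)) summable_on A"
    using M summable_on_iff_abs_summable_on_real[of M A] by simp
  then have intM: "integrable ?m M"
    by (simp only: abs_summable_equivalent Infinite_Set_Sum.abs_summable_on_def)
  have dom: "AE x in ?m. (\<lambda>n. f n x) \<longlonglongrightarrow> g x" "\<And>n. AE x in ?m. norm (f n x) \<le> M x"
    using lim bound by (simp_all add: AE_count_space)
  note int = integrable_dominated_convergence[OF _ _ intM dom, simplified]
    integral_dominated_convergence[OF _ _ intM dom, simplified]
    integrable_dominated_convergence2[OF _ _ intM dom, simplified]
  have eq: "h summable_on A \<and> infsum h A = integral\<^sup>L ?m h" if "integrable ?m h" for h :: "'a \<Rightarrow> real"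
  proof -
    have abs: "Infinite_Set_Sum.abs_summable_on h A"
      using that by (simp add: Infinite_Set_Sum.abs_summable_on_def)
    then have "(\<lambda>x. norm (h x)) summable_on A" by (simp only: abs_summable_equivalent)
    then have "h summable_on A" using summable_on_iff_abs_summable_on_real[of h A] by simp
    moreover have "infsum h A = integral\<^sup>L ?m h"
      using infsetsum_infsum[OF abs] by (simp add: infsetsum_def)
    ultimately show ?thesis ..
  qed
  have "integral\<^sup>L ?m (f n) = s n" for n
    using eq[OF int(3)[of n]] sums[of n] by (simp add: has_sum_iff)
  then have "integral\<^sup>L ?m g = l" using int(2) s LIMSEQ_unique by auto
  then show ?thesis using eq[OF int(1)] by (auto simp: has_sum_iff)
qed

section \<open>Normalized test functions and their limits\<close>

context weighted_graph
begin

lemma edgeE: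
  assumes "e \<in> E" obtains x y where "e = {x, y}" "x \<in> V" "y \<in> V"
  using simple[OF assms] that by (auto simp: card_2_iff)

lemma no_loops: "{x} \<notin> E"
  using simple[of "{x}"] by auto

lemma edge_diff_scale: "e \<in> E \<Longrightarrow> edge_diff (\<lambda>v. c * g v) e = \<bar>c\<bar> * edge_diff g e"
  by (erule edgeE) (simp add: edge_diff_pair abs_mult[symmetric] algebra_simps)

lemma edge_diff_cong:
  assumes "e \<in> E" "\<And>v. v \<in> e \<Longrightarrow> f v = g v"
  shows "edge_diff f e = edge_diff g e"
  using assms by (elim edgeE) (simp add: edge_diff_pair)

text \<open>A strict upper bound on an infimum is beaten by some competitor, and dividing the
  competitor by its norm turns its quotient into the value of the form. Singletons are excluded
  because their energy is infinite.\<close>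

lemma lambda2B_test_function:
  assumes "S \<subseteq> V" and less: "lambda2B E \<nu> \<omega> S < ennreal b"
  obtains g where "l2_norm_sq \<nu> S g = 1" "mean_zero \<nu> S g" "QB E \<omega> S g \<le> ennreal b"
proof -
  have b: "0 < b" using less by (metis ennreal_neg not_le not_less_zero zero_less_iff_neq_zero)
  have nu: "0 < \<nu> v" if "v \<in> S" for v using that assms(1) vertex_weight_pos by auto
  have nu_sq: "0 \<le> \<nu> v * \<bar>x\<bar>\<^sup>2" if "v \<in> S" for v x
    using nu[OF that] by simp
  have om_sq: "0 \<le> \<omega> e * x\<^sup>2" if "e \<in> induced_edges E S" for e x
    using that edge_weight_pos[of e] by (auto simp: induced_edges_def)
  obtain g v where g: "g \<in> domQB E \<nu> \<omega> S" "v \<in> S" "g v \<noteq> 0" "mean_zero \<nu> S g"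
    and quot: "QB E \<omega> S g / l2_norm_sq \<nu> S g < ennreal b"
    using less by (auto simp: lambda2B_def INF_less_iff split: if_splits)
  obtain q where q: "QB E \<omega> S g = ennreal q" "0 \<le> q"
    using g(1) by (cases "QB E \<omega> S g") (auto simp: domQB_def)
  obtain n where n: "l2_norm_sq \<nu> S g = ennreal n" "0 \<le> n"
    using g(1) by (cases "l2_norm_sq \<nu> S g") (auto simp: domQB_def)
  have q_sum: "((\<lambda>e. \<omega> e * (edge_diff g e)\<^sup>2) has_sum q) (induced_edges E S)"
    using infsum_ennreal_eq_iff[where f = "\<lambda>e. \<omega> e * (edge_diff g e)\<^sup>2", OF om_sq q(2)] q(1) by (simp add: QB_def)
  have n_sum: "((\<lambda>v. \<nu> v * \<bar>g v\<bar>\<^sup>2) has_sum n) S"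
    using infsum_ennreal_eq_iff[where f = "\<lambda>v. \<nu> v * \<bar>g v\<bar>\<^sup>2", OF nu_sq n(2)] n(1) by (simp add: l2_norm_sq_def)
  \<comment> \<open>A single nonzero value already makes the norm positive, which permits the
    division by \<open>sqrt n\<close>.\<close>
  have "\<nu> v * \<bar>g v\<bar>\<^sup>2 \<le> n"
    using finite_sum_le_has_sum[OF n_sum, of "{v}"] g nu_sq by simp
  moreover have "0 < \<nu> v * \<bar>g v\<bar>\<^sup>2" using g nu by simp
  ultimately have n_pos: "0 < n" by linarith
  have "q / n < b" using quot q n n_pos b by (simp add: divide_ennreal ennreal_less_iff)
  define h where "h = (\<lambda>v. (1 / sqrt n) * g v)"
  have "((\<lambda>v. (1 / n) * (\<nu> v * \<bar>g v\<bar>\<^sup>2)) has_sum (1 / n) * n) S"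
    by (rule has_sum_cmult_right[OF n_sum])
  then have "((\<lambda>v. \<nu> v * \<bar>h v\<bar>\<^sup>2) has_sum 1) S"
    using n_pos by (simp add: h_def abs_mult power_divide)
  then have "(\<Sum>\<^sub>\<infinity>v\<in>S. ennreal (\<nu> v * \<bar>h v\<bar>\<^sup>2)) = ennreal 1"
    using infsum_ennreal_eq_iff[where f = "\<lambda>v. \<nu> v * \<bar>h v\<bar>\<^sup>2", OF nu_sq zero_le_one, of S] by simp
  then have 1: "l2_norm_sq \<nu> S h = 1" by (simp add: l2_norm_sq_def)
  have scaled: "(1 / n) * (\<omega> e * (edge_diff g e)\<^sup>2) = \<omega> e * (edge_diff h e)\<^sup>2"
    if "e \<in> induced_edges E S" for e
  proof -
    have "edge_diff h e = \<bar>1 / sqrt n\<bar> * edge_diff g e"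
      unfolding h_def using that by (intro edge_diff_scale) (simp add: induced_edges_def)
    then have "(edge_diff h e)\<^sup>2 = (1 / n) * (edge_diff g e)\<^sup>2"
      using n_pos by (simp add: power_divide)
    then show ?thesis by simp
  qed
  have "((\<lambda>e. (1 / n) * (\<omega> e * (edge_diff g e)\<^sup>2)) has_sum (1 / n) * q) (induced_edges E S)"
    by (rule has_sum_cmult_right[OF q_sum])
  then have "((\<lambda>e. \<omega> e * (edge_diff h e)\<^sup>2) has_sum (1 / n) * q) (induced_edges E S)"
    using has_sum_cong[of "induced_edges E S" "\<lambda>e. (1 / n) * (\<omega> e * (edge_diff g e)\<^sup>2)"
        "\<lambda>e. \<omega> e * (edge_diff h e)\<^sup>2"] scaled by blast
  moreover have "0 \<le> (1 / n) * q" using q n_pos by simp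
  ultimately have "QB E \<omega> S h = ennreal (q / n)"
    using infsum_ennreal_eq_iff[where f = "\<lambda>e. \<omega> e * (edge_diff h e)\<^sup>2", OF om_sq,
        of "induced_edges E S" "(1 / n) * q"]
    by (simp add: QB_def)
  then have 2: "QB E \<omega> S h \<le> ennreal b" using \<open>q / n < b\<close> by (simp add: ennreal_leI)
  have "((\<lambda>v. (1 / sqrt n) * (\<nu> v * g v)) has_sum (1 / sqrt n) * 0) S"
    using g(4) unfolding mean_zero_def by (rule has_sum_cmult_right)
  then have "mean_zero \<nu> S h" by (simp add: mean_zero_def h_def mult_ac)
  then show thesis using that 1 2 by blast
qed

text \<open>Norm one excludes the zero function. Together with mean zero it excludes a singleton,
  where mean zero would force \<open>g\<close> to vanish. So \<open>g\<close> is a competitor, and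
  its quotient is the form itself.\<close>

lemma lambda2B_le:
  assumes S: "S \<subseteq> V" and norm: "l2_norm_sq \<nu> S g = 1" and mean: "mean_zero \<nu> S g"
    and Q: "QB E \<omega> S g \<le> ennreal b"
  shows "lambda2B E \<nu> \<omega> S \<le> ennreal b"
proof -
  have ne: "\<exists>v\<in>S. g v \<noteq> 0"
  proof (rule ccontr)
    assume "\<not> ?thesis"
    then have "l2_norm_sq \<nu> S g = (\<Sum>\<^sub>\<infinity>v\<in>S. 0)"
      unfolding l2_norm_sq_def by (intro infsum_cong) auto
    with norm show False by simp
  qed
  have "\<not> is_singleton S"
  proof
    assume "is_singleton S"
    then obtain v where "S = {v}" by (auto simp: is_singleton_def)
    then have "\<nu> v * g v = 0" using mean by (simp add: mean_zero_def has_sum_finite_iff)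
    moreover have "\<nu> v > 0" using S \<open>S = {v}\<close> by (intro vertex_weight_pos) simp
    ultimately show False using ne \<open>S = {v}\<close> by simp
  qed
  moreover have "QB E \<omega> S g < \<infinity>" using Q by (simp add: le_less_trans)
  then have "g \<in> domQB E \<nu> \<omega> S" using norm by (simp add: domQB_def)
  then have "(INF g\<in>{g \<in> domQB E \<nu> \<omega> S. (\<exists>v\<in>S. g v \<noteq> 0) \<and> mean_zero \<nu> S g}.
             QB E \<omega> S g / l2_norm_sq \<nu> S g) \<le> ennreal b"
    using ne mean norm Q by (intro INF_lower2[of g]) (auto simp: divide_ennreal_def)
  ultimately show ?thesis by (simp add: lambda2B_def)
qed

text \<open>Extension by zero moves the test functions to the fixed set \<open>V\<close>, where norm
  and mean are dominated by a constant multiple of \<open>\<nu>\<close>. The form cannot be extended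
  in this way, because cutting off at the edge of a cell creates new differences. It is therefore
  compared only on finite sets of edges inside \<open>S\<close>, which for late indices are also
  edges inside \<open>T n\<close>.\<close>

lemma lambda2B_lower_semicontinuous:
  assumes fin: "\<nu> summable_on V" and T: "\<And>n. T n \<subseteq> V" and S: "S \<subseteq> V"
    and lim: "\<And>v. v \<in> V \<Longrightarrow> \<forall>\<^sub>F n in sequentially. v \<in> T n \<longleftrightarrow> v \<in> S"
    and norm: "\<And>n. l2_norm_sq \<nu> (T n) (f n) = 1"
    and mean: "\<And>n. mean_zero \<nu> (T n) (f n)"
    and Q: "\<And>n. QB E \<omega> (T n) (f n) \<le> ennreal (a n)"
    and bound: "\<And>n v. v \<in> T n \<Longrightarrow> \<bar>f n v\<bar> \<le> K"
    and a: "a \<longlonglongrightarrow> l" "\<And>n. 0 \<le> a n"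
  shows "S \<noteq> {}" "lambda2B E \<nu> \<omega> S \<le> ennreal l"
proof -
  have nu: "0 \<le> \<nu> v" if "v \<in> V" for v using that vertex_weight_pos by (auto intro: less_imp_le)
  define h where "h n v = (if v \<in> T n then f n v else 0)" for n v
  have h_bound: "\<bar>h n v\<bar> \<le> \<bar>K\<bar>" for n v
    using bound[of v n] by (auto simp: h_def)
  obtain r where r: "strict_mono (r :: nat \<Rightarrow> nat)"
    and "\<And>v. v \<in> V \<Longrightarrow> \<exists>x. (\<lambda>n. h (r n) v) \<longlonglongrightarrow> x"
    using function_convergent_subsequence[OF countable_vertices, of h "\<bar>K\<bar>"] h_bound by auto
  then obtain \<phi> where \<phi>: "\<And>v. v \<in> V \<Longrightarrow> (\<lambda>n. h (r n) v) \<longlonglongrightarrow> \<phi> v" by metis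
  have ev: "\<forall>\<^sub>F n in sequentially. v \<in> T (r n) \<longleftrightarrow> v \<in> S" if "v \<in> V" for v
    using lim[OF that] eventually_subseq[OF r] by blast
  have out: "\<phi> v = 0" if "v \<in> V - S" for v
  proof -
    have "\<forall>\<^sub>F n in sequentially. h (r n) v = 0"
      using ev[of v] that by (auto simp: h_def elim: eventually_mono)
    then have "(\<lambda>n. h (r n) v) \<longlonglongrightarrow> 0" by (rule tendsto_eventually)
    then show ?thesis using \<phi>[of v] that LIMSEQ_unique by blast
  qed
  have extend: "(F has_sum x) V \<longleftrightarrow> (G has_sum x) B"
    if "B \<subseteq> V" "\<And>v. v \<in> B \<Longrightarrow> F v = G v" "\<And>v. v \<in> V - B \<Longrightarrow> F v = 0"
    for F G :: "'a \<Rightarrow> real" and x B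
    using that by (intro has_sum_cong_neutral) auto
  have mean_h: "((\<lambda>v. \<nu> v * h n v) has_sum 0) V" for n
    by (rule extend[THEN iffD2, OF T _ _ mean[of n, unfolded mean_zero_def]])
      (simp_all add: h_def)
  have "((\<lambda>v. \<nu> v * \<phi> v) has_sum 0) V"
  proof (rule has_sum_dominated_convergence)
    show "(\<lambda>n. \<nu> v * h (r n) v) \<longlonglongrightarrow> \<nu> v * \<phi> v" if "v \<in> V" for v
      using \<phi>[OF that] by (rule tendsto_mult_left)
    show "\<bar>\<nu> v * h (r n) v\<bar> \<le> \<nu> v * \<bar>K\<bar>" if "v \<in> V" for n v
      using nu[OF that] h_bound by (simp add: abs_mult mult_left_mono)
    show "(\<lambda>v. \<nu> v * \<bar>K\<bar>) summable_on V" using fin by (rule summable_on_cmult_left)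
  qed (rule mean_h, rule tendsto_const)
  then have mean_S: "mean_zero \<nu> S \<phi>"
    unfolding mean_zero_def by (rule extend[THEN iffD1, OF S _ _, rotated -1]) (simp_all add: out)
  have norm_f: "((\<lambda>v. \<nu> v * \<bar>f n v\<bar>\<^sup>2) has_sum 1) (T n)" for n
    using norm[of n] nu[OF T[THEN subsetD]]
      infsum_ennreal_eq_iff[of "T n" "\<lambda>v. \<nu> v * \<bar>f n v\<bar>\<^sup>2" 1]
    by (simp add: l2_norm_sq_def)
  have norm_h: "((\<lambda>v. \<nu> v * \<bar>h n v\<bar>\<^sup>2) has_sum 1) V" for n
    by (rule extend[THEN iffD2, OF T _ _ norm_f[of n]]) (simp_all add: h_def)
  have "((\<lambda>v. \<nu> v * \<bar>\<phi> v\<bar>\<^sup>2) has_sum 1) V"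
  proof (rule has_sum_dominated_convergence)
    show "(\<lambda>n. \<nu> v * \<bar>h (r n) v\<bar>\<^sup>2) \<longlonglongrightarrow> \<nu> v * \<bar>\<phi> v\<bar>\<^sup>2" if "v \<in> V" for v
      using \<phi>[OF that] by (intro tendsto_intros)
    show "\<bar>\<nu> v * \<bar>h (r n) v\<bar>\<^sup>2\<bar> \<le> \<nu> v * \<bar>K\<bar>\<^sup>2" if "v \<in> V" for n v
      using nu[OF that] power_mono[OF h_bound abs_ge_zero, of "r n" v 2]
      by (simp add: abs_mult mult_left_mono)
    show "(\<lambda>v. \<nu> v * \<bar>K\<bar>\<^sup>2) summable_on V" using fin by (rule summable_on_cmult_left)
  qed (rule norm_h, rule tendsto_const)
  then have "((\<lambda>v. \<nu> v * \<bar>\<phi> v\<bar>\<^sup>2) has_sum 1) S"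
    by (rule extend[THEN iffD1, OF S _ _, rotated -1]) (simp_all add: out)
  then have "(\<Sum>\<^sub>\<infinity>v\<in>S. ennreal (\<nu> v * \<bar>\<phi> v\<bar>\<^sup>2)) = ennreal 1"
    using nu[OF S[THEN subsetD]] infsum_ennreal_eq_iff[of S "\<lambda>v. \<nu> v * \<bar>\<phi> v\<bar>\<^sup>2" 1] by simp
  then have norm_S: "l2_norm_sq \<nu> S \<phi> = 1" by (simp add: l2_norm_sq_def)
  \<comment> \<open>Over the empty set the norm would be 0, but the limit has kept norm one.\<close>
  then show "S \<noteq> {}" by (auto simp: l2_norm_sq_def)
  have a_r: "(\<lambda>n. a (r n)) \<longlonglongrightarrow> l" using a(1) r by (rule LIMSEQ_subseq_LIMSEQ[unfolded o_def])
  \<comment> \<open>A Fatou argument: a sum of nonnegative terms is controlled by its finite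
    subsums, and on finitely many edges the differences converge.\<close>
  have "QB E \<omega> S \<phi> \<le> ennreal l"
    unfolding QB_def
  proof (rule infsum_le_finite_sums)
    fix F assume F: "finite F" "F \<subseteq> induced_edges E S"
    have om: "0 \<le> \<omega> e * x\<^sup>2" if "e \<in> F" for e x
      using that F edge_weight_pos[of e] by (auto simp: induced_edges_def)
    have "(\<Sum>e\<in>F. \<omega> e * (edge_diff \<phi> e)\<^sup>2) \<le> l"
    proof (rule LIMSEQ_le[OF _ a_r])
      have "(\<lambda>n. edge_diff (h (r n)) e) \<longlonglongrightarrow> edge_diff \<phi> e" if "e \<in> F" for e
      proof -
        have "e \<in> E" using that F by (auto simp: induced_edges_def)
        then obtain x y where "e = {x, y}" "x \<in> V" "y \<in> V" by (rule edgeE)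
        then show ?thesis using \<phi> by (auto simp: edge_diff_pair intro!: tendsto_intros)
      qed
      then show "(\<lambda>n. \<Sum>e\<in>F. \<omega> e * (edge_diff (h (r n)) e)\<^sup>2) \<longlonglongrightarrow> (\<Sum>e\<in>F. \<omega> e * (edge_diff \<phi> e)\<^sup>2)"
        by (auto intro!: tendsto_intros)
      have "finite (\<Union>F)"
      proof (rule finite_Union[OF F(1)])
        fix e assume "e \<in> F"
        then have "card e = 2" using F simple by (auto simp: induced_edges_def)
        then show "finite e" by (metis card.infinite zero_neq_numeral)
      qed
      moreover have FS: "\<Union>F \<subseteq> S" using F by (auto simp: induced_edges_def)
      moreover have "\<forall>v\<in>\<Union>F. \<forall>\<^sub>F n in sequentially. v \<in> T (r n) \<longleftrightarrow> v \<in> S"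
        using ev FS S by blast
      ultimately have "\<forall>\<^sub>F n in sequentially. \<forall>v\<in>\<Union>F. v \<in> T (r n) \<longleftrightarrow> v \<in> S"
        by (simp only: eventually_ball_finite_distrib)
      then have "\<forall>\<^sub>F n in sequentially. (\<Sum>e\<in>F. \<omega> e * (edge_diff (h (r n)) e)\<^sup>2) \<le> a (r n)"
      proof eventually_elim
        case (elim n)
        then have sub: "\<Union>F \<subseteq> T (r n)" using FS by blast
        have "(\<Sum>e\<in>F. ennreal (\<omega> e * (edge_diff (h (r n)) e)\<^sup>2))
            = (\<Sum>e\<in>F. ennreal (\<omega> e * (edge_diff (f (r n)) e)\<^sup>2))"
        proof (rule sum.cong[OF refl])
          fix e assume "e \<in> F"
          then have "edge_diff (h (r n)) e = edge_diff (f (r n)) e"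
            using F(2) sub by (intro edge_diff_cong) (auto simp: induced_edges_def h_def)
          then show "ennreal (\<omega> e * (edge_diff (h (r n)) e)\<^sup>2) = ennreal (\<omega> e * (edge_diff (f (r n)) e)\<^sup>2)"
            by simp
        qed
        also have "\<dots> \<le> QB E \<omega> (T (r n)) (f (r n))"
          unfolding QB_def infsum_finite[OF F(1), symmetric] using F(2) sub
          by (intro infsum_mono_neutral)
            (auto simp: induced_edges_def intro: nonneg_summable_on_complete)
        also have "\<dots> \<le> ennreal (a (r n))" by (rule Q)
        finally have "ennreal (\<Sum>e\<in>F. \<omega> e * (edge_diff (h (r n)) e)\<^sup>2) \<le> ennreal (a (r n))"
          using om by (simp add: sum_ennreal)
        then show ?case using a(2) by (simp add: ennreal_le_iff)
      qed
      then show "\<exists>N. \<forall>n\<ge>N. (\<Sum>e\<in>F. \<omega> e * (edge_diff (h (r n)) e)\<^sup>2) \<le> a (r n)"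
        by (simp add: eventually_sequentially)
    qed
    then show "(\<Sum>e\<in>F. ennreal (\<omega> e * (edge_diff \<phi> e)\<^sup>2)) \<le> ennreal l"
      using om by (simp add: sum_ennreal ennreal_leI)
  qed (simp add: nonneg_summable_on_complete)
  then show "lambda2B E \<nu> \<omega> S \<le> ennreal l" using lambda2B_le[OF S norm_S mean_S] by simp
qed

end

text \<open>
  The embedding in the assumption bounds the test functions of the converging cells, which
  prevents their mass from escaping to infinity.
\<close>

lemma (in weighted_graph) lambda2B_limit:
  assumes fin: "\<nu> summable_on V" and C: "C > 0"
    and sobolev: "\<And>S f. S \<subseteq> V \<Longrightarrow> induces_connected E S \<Longrightarrow> f \<in> domQB E \<nu> \<omega> S \<Longrightarrow>
      mean_zero \<nu> S f \<Longrightarrow> linf_norm S f \<le> ennreal C * ennpowr (QB E \<omega> S f) (1 / 2)"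
    and T: "\<And>n. T n \<subseteq> V" "\<And>n. induces_connected E (T n)" and S: "S \<subseteq> V"
    and lim: "\<And>v. v \<in> V \<Longrightarrow> \<forall>\<^sub>F n in sequentially. v \<in> T n \<longleftrightarrow> v \<in> S"
    and x: "\<And>n. lambda2B E \<nu> \<omega> (T n) \<le> ennreal (x n)" "x \<longlonglongrightarrow> l" "\<And>n. 0 \<le> x n"
  shows "S \<noteq> {}" "lambda2B E \<nu> \<omega> S \<le> ennreal l"
proof -
  \<comment> \<open>The slack provides the strict inequality needed to extract a test function, and
    it vanishes in the limit.\<close>
  define a where "a n = x n + 1 / real (Suc n)" for n
  have a: "a \<longlonglongrightarrow> l" "\<And>n. 0 \<le> a n"
    using tendsto_add[OF x(2) LIMSEQ_inverse_real_of_nat] x(3)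
    by (auto simp: a_def[abs_def] inverse_eq_divide)
  have "\<exists>f. l2_norm_sq \<nu> (T n) f = 1 \<and> mean_zero \<nu> (T n) f \<and> QB E \<omega> (T n) f \<le> ennreal (a n)" for n
  proof -
    have "ennreal (x n) < ennreal (a n)"
      using x(3) by (subst ennreal_less_iff) (auto simp: a_def)
    then have "lambda2B E \<nu> \<omega> (T n) < ennreal (a n)" using x(1) by (rule le_less_trans[rotated])
    with T(1) show ?thesis by (rule lambda2B_test_function) blast
  qed
  then obtain f where f: "\<And>n. l2_norm_sq \<nu> (T n) (f n) = 1" "\<And>n. mean_zero \<nu> (T n) (f n)"
    "\<And>n. QB E \<omega> (T n) (f n) \<le> ennreal (a n)" by metis
  obtain A where A: "\<And>n. a n \<le> A"
    using convergent_imp_Bseq[OF convergentI[OF a(1)]] by (auto simp: Bseq_def abs_le_iff)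
  \<comment> \<open>The constant \<open>C\<close> is the same for all connected sets, so a common
    bound \<open>A\<close> on the forms gives one sup bound for all cells.\<close>
  have bound: "\<bar>f n v\<bar> \<le> C * sqrt A" if "v \<in> T n" for n v
  proof -
    have Q: "QB E \<omega> (T n) (f n) \<le> ennreal A"
      using f(3)[of n] ennreal_leI[OF A[of n]] by (rule order_trans)
    then have Q_fin: "QB E \<omega> (T n) (f n) < \<infinity>" by (simp add: le_less_trans)
    then obtain q where q: "QB E \<omega> (T n) (f n) = ennreal q" "0 \<le> q"
      by (cases "QB E \<omega> (T n) (f n)") auto
    have "0 \<le> A" using a(2) A by (rule order_trans)
    with Q q have "q \<le> A" by simp
    have "f n \<in> domQB E \<nu> \<omega> (T n)" using Q_fin f(1) by (simp add: domQB_def)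
    then have "linf_norm (T n) (f n) \<le> ennreal C * ennpowr (ennreal q) (1 / 2)"
      using sobolev[OF T _ f(2)] q(1) by metis
    also have "\<dots> = ennreal (C * sqrt q)"
      using q C by (simp add: ennpowr_def powr_half_sqrt ennreal_mult')
    also have "\<dots> \<le> ennreal (C * sqrt A)"
      using \<open>q \<le> A\<close> C by (intro ennreal_leI) simp
    finally have "linf_norm (T n) (f n) \<le> ennreal (C * sqrt A)" .
    moreover have "ennreal \<bar>f n v\<bar> \<le> linf_norm (T n) (f n)"
      unfolding linf_norm_def by (rule SUP_upper[OF that])
    ultimately have "ennreal \<bar>f n v\<bar> \<le> ennreal (C * sqrt A)" by (rule order_trans[rotated])
    then show ?thesis using C \<open>0 \<le> A\<close> by (simp add: ennreal_le_iff)
  qed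
  show "S \<noteq> {}" "lambda2B E \<nu> \<omega> S \<le> ennreal l"
    by (rule lambda2B_lower_semicontinuous[OF fin T(1) S lim f bound a]; assumption)+
qed

subsection \<open>Power means of energies\<close>

text \<open>The mean is separated from the energies so that it can also be taken of the limits
  \<open>y j\<close>, which are not known to be energies of any cells.\<close>

definition power_mean :: "nat \<Rightarrow> ennreal \<Rightarrow> (nat \<Rightarrow> ennreal) \<Rightarrow> ennreal" where
  "power_mean k p a =
     (if p = \<infinity> then Max (a ` {1..k})
      else ennpowr ((\<Sum>j=1..k. ennpowr (a j) (enn2real p)) / of_nat k) (1 / enn2real p))"

lemma partition_energy_eq:
  "partition_energy E \<nu> \<omega> k p P = power_mean k p (\<lambda>j. lambda2B E \<nu> \<omega> (P j))"
  by (simp add: partition_energy_def power_mean_def)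

lemma power_mean_ennreal:
  assumes "p \<noteq> \<infinity>" "1 \<le> k" "\<And>j. 0 \<le> x j"
  shows "power_mean k p (\<lambda>j. ennreal (x j)) =
    ennreal (((\<Sum>j=1..k. x j powr enn2real p) / real k) powr (1 / enn2real p))"
proof -
  have "(\<Sum>j=1..k. ennpowr (ennreal (x j)) (enn2real p)) / of_nat k
      = ennreal ((\<Sum>j=1..k. x j powr enn2real p) / real k)"
    using assms
    by (simp add: ennpowr_def ennreal_of_nat_eq_real_of_nat divide_ennreal sum_nonneg)
  then show ?thesis
    using assms by (simp add: power_mean_def ennpowr_def sum_nonneg)
qed

lemma power_mean_cong:
  assumes "\<And>j. j \<in> {1..k} \<Longrightarrow> a j = b j"
  shows "power_mean k p a = power_mean k p b"
proof -
  have "a ` {1..k} = b ` {1..k}" using assms by (rule image_cong[OF refl])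
  moreover have "(\<Sum>j=1..k. ennpowr (a j) q) = (\<Sum>j=1..k. ennpowr (b j) q)" for q
    using assms by (intro sum.cong) auto
  ultimately show ?thesis by (simp only: power_mean_def)
qed

lemma one_le_enn2real:
  assumes "1 \<le> p" "p \<noteq> \<infinity>"
  shows "1 \<le> enn2real p"
  using assms by (cases p) auto

text \<open>With \<open>q\<close> the finite exponent and M the mean, x_j^q is at most k M^q, hence
  x_j is at most k^(1/q) M, and k^(1/q) is at most k since q is at least 1. The cruder factor
  \<open>k\<close> also covers the maximum.\<close>

lemma le_power_mean:
  assumes k: "1 \<le> k" and p: "1 \<le> p" and j: "j \<in> {1..k}" and le: "power_mean k p a \<le> ennreal B"
  shows "a j \<le> ennreal (real k * B)"
proof (cases "p = \<infinity>")
  case True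
  then have "a j \<le> ennreal B"
    using j le Max_ge[of "a ` {1..k}" "a j"] by (auto simp: power_mean_def intro: order_trans)
  also have "ennreal B \<le> ennreal (real k * B)"
    using k mult_right_mono[of 1 "real k" B]
    by (cases "0 \<le> B") (auto simp: ennreal_neg intro!: ennreal_leI)
  finally show ?thesis .
next
  case False
  define q where "q = enn2real p"
  have q: "1 \<le> q" using one_le_enn2real[OF p False] by (simp add: q_def)
  \<comment> \<open>One infinite entry makes the whole mean infinite, so under the bound the
    computation can move to the reals.\<close>
  have fin: "a i \<noteq> \<infinity>" if "i \<in> {1..k}" for i
  proof
    assume "a i = \<infinity>"
    then have "\<infinity> \<le> (\<Sum>j=1..k. ennpowr (a j) q)"
      using member_le_sum[OF that, of "\<lambda>j. ennpowr (a j) q"] by (simp add: ennpowr_def)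
    then have sum_top: "(\<Sum>j=1..k. ennpowr (a j) q) = \<infinity>" by (simp add: top_unique)
    have "(\<Sum>j=1..k. ennpowr (a j) q) / of_nat k = \<infinity>"
      unfolding sum_top by (simp add: ennreal_top_divide ennreal_of_nat_eq_real_of_nat)
    then have "power_mean k p a = \<infinity>"
      using False unfolding power_mean_def q_def[symmetric] by (simp add: ennpowr_def)
    then show False using le by (simp add: top_unique)
  qed
  define x where "x i = enn2real (a i)" for i
  have x: "0 \<le> x i" for i by (simp add: x_def)
  have ax: "a i = ennreal (x i)" if "i \<in> {1..k}" for i
    using fin[OF that] by (simp add: x_def less_top)
  let ?m = "(\<Sum>j=1..k. x j powr q) / real k"
  have "power_mean k p a = ennreal (?m powr (1 / q))"
    using power_mean_cong[of k a "\<lambda>j. ennreal (x j)" p] ax power_mean_ennreal[of p k x, OF False k x]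
    by (simp add: q_def)
  with le have pm: "ennreal (?m powr (1 / q)) \<le> ennreal B" by simp
  have "x j powr q \<le> (\<Sum>j=1..k. x j powr q)"
    using j by (intro member_le_sum) auto
  also have "\<dots> = real k * ?m" using k by simp
  finally have "(x j powr q) powr (1 / q) \<le> (real k * ?m) powr (1 / q)"
    using q by (intro powr_mono2) auto
  moreover have "(x j powr q) powr (1 / q) = x j"
    using q x[of j] by (simp add: powr_powr)
  moreover have "(real k * ?m) powr (1 / q) = real k powr (1 / q) * ?m powr (1 / q)"
    by (rule powr_mult)
  ultimately have "x j \<le> real k powr (1 / q) * ?m powr (1 / q)" by simp
  also have "\<dots> \<le> real k * ?m powr (1 / q)"
    using k q powr_mono[of "1 / q" 1 "real k"] by (intro mult_right_mono) auto
  finally have xj: "x j \<le> real k * ?m powr (1 / q)" .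
  from pm have "ennreal (real k) * ennreal (?m powr (1 / q)) \<le> ennreal (real k) * ennreal B"
    by (rule mult_left_mono) simp
  then have "ennreal (real k * ?m powr (1 / q)) \<le> ennreal (real k * B)"
    by (simp add: ennreal_mult')
  with ennreal_leI[OF xj] show ?thesis
    unfolding ax[OF j] by (rule order_trans)
qed

lemma power_mean_mono:
  assumes k: "1 \<le> k" and "\<And>j. j \<in> {1..k} \<Longrightarrow> a j \<le> b j"
  shows "power_mean k p a \<le> power_mean k p b"
proof (cases "p = \<infinity>")
  case True
  have "Max (a ` {1..k}) \<le> Max (b ` {1..k})"
  proof (rule Max.boundedI)
    fix c assume "c \<in> a ` {1..k}"
    then obtain j where j: "j \<in> {1..k}" "c = a j" by blast
    then have "c \<le> b j" using assms(2) by simp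
    also have "b j \<le> Max (b ` {1..k})" using j(1) by (intro Max_ge) auto
    finally show "c \<le> Max (b ` {1..k})" .
  qed (use k in auto)
  then show ?thesis using True by (simp add: power_mean_def)
next
  case False
  have mono: "ennpowr x r \<le> ennpowr y r" if "x \<le> y" "0 \<le> r" for x y r
    using that by (auto simp: ennpowr_def top_unique less_top enn2real_mono intro!: ennreal_leI powr_mono2)
  show ?thesis
    unfolding power_mean_def using False assms(2)
    by (auto intro!: mono divide_right_mono_ennreal sum_mono)
qed

text \<open>For a finite exponent the mean is continuous in its finitely many entries, also at 0
  because the exponents are positive. For the maximum the bound passes to the limit entry by
  entry.\<close>

lemma power_mean_limit:
  assumes k: "1 \<le> k" and p: "1 \<le> p" and x: "\<And>n j. 0 \<le> x n j" and y: "\<And>j. 0 \<le> y j"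
    and lim: "\<And>j. j \<in> {1..k} \<Longrightarrow> (\<lambda>n. x n j) \<longlonglongrightarrow> y j"
    and le: "\<And>n. power_mean k p (\<lambda>j. ennreal (x n j)) \<le> ennreal (b n)"
    and b: "b \<longlonglongrightarrow> B" "\<And>n. 0 \<le> b n"
  shows "power_mean k p (\<lambda>j. ennreal (y j)) \<le> ennreal B"
proof (cases "p = \<infinity>")
  case True
  have "y j \<le> B" if "j \<in> {1..k}" for j
  proof (rule LIMSEQ_le[OF lim[OF that] b(1)])
    have "ennreal (x n j) \<le> ennreal (b n)" for n
      using le[of n] True that Max_ge[of "(\<lambda>j. ennreal (x n j)) ` {1..k}" "ennreal (x n j)"]
      by (auto simp: power_mean_def intro: order_trans)
    then show "\<exists>N. \<forall>n\<ge>N. x n j \<le> b n" using b(2) by (simp add: ennreal_le_iff)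
  qed
  then show ?thesis
    using True k by (auto simp: power_mean_def ennreal_leI)
next
  case False
  define q where "q = enn2real p"
  have q: "1 \<le> q" using one_le_enn2real[OF p False] by (simp add: q_def)
  have "((\<Sum>j=1..k. y j powr q) / real k) powr (1 / q) \<le> B"
  proof (rule LIMSEQ_le[OF _ b(1)])
    have "(\<lambda>n. x n j powr q) \<longlonglongrightarrow> y j powr q" if "j \<in> {1..k}" for j
      using q x by (intro tendsto_powr'[OF lim[OF that]]) auto
    then have "(\<lambda>n. \<Sum>j=1..k. x n j powr q) \<longlonglongrightarrow> (\<Sum>j=1..k. y j powr q)"
      by (rule tendsto_sum)
    then have "(\<lambda>n. (\<Sum>j=1..k. x n j powr q) / real k) \<longlonglongrightarrow> (\<Sum>j=1..k. y j powr q) / real k"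
      using k by (intro tendsto_divide tendsto_const) auto
    then show "(\<lambda>n. ((\<Sum>j=1..k. x n j powr q) / real k) powr (1 / q))
        \<longlonglongrightarrow> ((\<Sum>j=1..k. y j powr q) / real k) powr (1 / q)"
      using q by (rule_tac tendsto_powr') (auto simp: sum_nonneg)
    have "((\<Sum>j=1..k. x n j powr q) / real k) powr (1 / q) \<le> b n" for n
      using le[of n] b(2)[of n] power_mean_ennreal[of p k "x n", OF False k x]
      by (simp add: q_def ennreal_le_iff)
    then show "\<exists>N. \<forall>n\<ge>N. ((\<Sum>j=1..k. x n j powr q) / real k) powr (1 / q) \<le> b n" by blast
  qed
  then show ?thesis
    using power_mean_ennreal[of p k y, OF False k y] by (simp add: q_def ennreal_leI)
qed

subsection \<open>Existence of optimal partitions\<close>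

text \<open>A limit above 1/2 eventually excludes the value 0, and a limit below 1 eventually
  excludes the value 1. With membership encoded as numbers, compactness of bounded sequences can
  thus decide it.\<close>

lemma convergent_of_bool:
  assumes "(\<lambda>n. of_bool (b n) :: real) \<longlonglongrightarrow> l"
  shows "(\<forall>\<^sub>F n in sequentially. b n) \<or> (\<forall>\<^sub>F n in sequentially. \<not> b n)"
proof (cases "l > 1 / 2")
  case True
  from order_tendstoD(1)[OF assms this] have "\<forall>\<^sub>F n in sequentially. b n"
    by (rule eventually_mono) (simp add: of_bool_def split: if_splits)
  then show ?thesis ..
next
  case False
  then have "l < 1" by simp
  from order_tendstoD(2)[OF assms this] have "\<forall>\<^sub>F n in sequentially. \<not> b n"
    by (rule eventually_mono) (simp add: of_bool_def split: if_splits)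
  then show ?thesis ..
qed

theorem theorem3p14:
  fixes V :: "'a set" and E :: "'a set set"
    and \<nu> :: "'a \<Rightarrow> real" and \<omega> :: "'a set \<Rightarrow> real"
    and k :: nat and p :: ennreal
  assumes graph: "weighted_graph V E \<nu> \<omega>"
    and finite_measure: "vertex_measure \<nu> V < \<infinity>"
    and k: "1 \<le> k" "finite V \<longrightarrow> k \<le> card V"
    and p: "1 \<le> p"
    and sobolev: "\<exists>C::real. C > 0 \<and>
      (\<forall>V0 f. V0 \<subseteq> V \<longrightarrow> induces_connected E V0 \<longrightarrow> f \<in> domQB E \<nu> \<omega> V0 \<longrightarrow> mean_zero \<nu> V0 f \<longrightarrow>
        linf_norm V0 f \<le> ennreal C * ennpowr (QB E \<omega> V0 f) (1 / 2))"
    and finite_paths: "\<forall>v\<in>V. \<forall>w\<in>V. v \<noteq> w \<longrightarrow>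
      finite {xs. is_path V E v w xs \<and> non_contractible E xs}"
  shows "\<exists>P\<in>connected_partitions V E k.
      minimal_energy V E \<nu> \<omega> k p = partition_energy E \<nu> \<omega> k p P"
proof -
  interpret weighted_graph V E \<nu> \<omega> by (rule graph)
  let ?CP = "connected_partitions V E k" and ?L = "minimal_energy V E \<nu> \<omega> k p"
  let ?\<Lambda> = "partition_energy E \<nu> \<omega> k p"
  obtain C where C: "C > 0" and sob: "\<And>S f. S \<subseteq> V \<Longrightarrow> induces_connected E S \<Longrightarrow>
      f \<in> domQB E \<nu> \<omega> S \<Longrightarrow> mean_zero \<nu> S f \<Longrightarrow>
      linf_norm S f \<le> ennreal C * ennpowr (QB E \<omega> S f) (1 / 2)"
    using sobolev by blast
  have L_le: "?L \<le> ?\<Lambda> P" if "P \<in> ?CP" for P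
    unfolding minimal_energy_def using that by (rule INF_lower)
  have "\<exists>P\<in>?CP. ?\<Lambda> P \<le> ?L"
  proof (cases "?L = \<infinity>")
    case True
    then show ?thesis using connected_partitions_nonempty[OF connected k] by auto
  next
    case False
    then obtain m where m: "?L = ennreal m" "0 \<le> m" by (cases ?L) auto
    obtain c where "vertex_measure \<nu> V = ennreal c" "0 \<le> c"
      using finite_measure by (cases "vertex_measure \<nu> V") auto
    then have fin: "\<nu> summable_on V"
      using infsum_ennreal_eq_iff[of V \<nu> c] vertex_weight_pos
      by (auto simp: vertex_measure_def has_sum_iff intro: less_imp_le)
    define b where "b n = m + 1 / real (Suc n)" for n
    have b: "b \<longlonglongrightarrow> m" "\<And>n. 0 \<le> b n"
      using tendsto_add[OF tendsto_const[of m] LIMSEQ_inverse_real_of_nat] m(2)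
      by (auto simp: b_def[abs_def] inverse_eq_divide)
    have "\<exists>P\<in>?CP. ?\<Lambda> P < ennreal (b n)" for n
    proof -
      have "?L < ennreal (b n)"
        unfolding m(1) using m(2) by (subst ennreal_less_iff) (auto simp: b_def)
      then show ?thesis by (simp add: minimal_energy_def INF_less_iff)
    qed
    then obtain P where P: "\<And>n. P n \<in> ?CP" "\<And>n. ?\<Lambda> (P n) < ennreal (b n)" by metis
    have P_con: "induces_connected E (P n j)" and P_sub: "P n j \<subseteq> V" if "j \<in> {1..k}" for n j
      using P(1)[of n] that by (auto simp: connected_partitions_def k_partition_def)
    have P_disj: "disjoint_family_on (P n) {1..k}" and P_un: "(\<Union>j\<in>{1..k}. P n j) = V" for n
      using P(1)[of n] by (auto simp: connected_partitions_def k_partition_def)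
    define x where "x n j = enn2real (lambda2B E \<nu> \<omega> (P n j))" for n j
    have x0: "0 \<le> x n j" for n j by (simp add: x_def)
    \<comment> \<open>Every energy along the sequence is thereby finite; in particular no cell is a
      singleton.\<close>
    have lam_le: "lambda2B E \<nu> \<omega> (P n j) \<le> ennreal (real k * b n)" if "j \<in> {1..k}" for n j
      using le_power_mean[OF k(1) p that, of "\<lambda>j. lambda2B E \<nu> \<omega> (P n j)" "b n"] P(2)[of n]
      by (simp add: partition_energy_eq less_imp_le)
    then have lam: "lambda2B E \<nu> \<omega> (P n j) = ennreal (x n j)" if "j \<in> {1..k}" for n j
      unfolding x_def using that by (metis ennreal_enn2real ennreal_less_top le_less_trans)
    have "b n \<le> m + 1" for n by (simp add: b_def field_simps)
    then have "x n j \<le> real k * (m + 1)" if "j \<in> {1..k}" for n j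
    proof -
      have "x n j \<le> real k * b n"
        using lam_le[OF that, of n] lam[OF that, of n] b(2)[of n] by simp
      also have "\<dots> \<le> real k * (m + 1)" using \<open>\<And>n. b n \<le> m + 1\<close> by (rule mult_left_mono) simp
      finally show ?thesis .
    qed
    note x_bound = this
    text \<open>One diagonal subsequence serves the cells and their eigenvalues at once.\<close>
    define g :: "nat \<Rightarrow> ('a \<times> nat) + nat \<Rightarrow> real" where
      "g n = case_sum (\<lambda>(v, j). of_bool (v \<in> P n j)) (x n)" for n
    \<comment> \<open>Left indices carry the membership of a vertex in a cell, bounded by 1; right
      indices carry the cell energies, bounded by \<open>x_bound\<close>.\<close>
    let ?I = "Inl ` (V \<times> {1..k}) \<union> Inr ` {1..k}"
    have I: "countable ?I" using countable_vertices by auto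
    have g: "norm (g n i) \<le> max 1 (real k * (m + 1))" if "i \<in> ?I" for n i
      using that x_bound[of _ n] x0 by (auto simp: g_def le_max_iff_disj)
    obtain r where r: "strict_mono (r :: nat \<Rightarrow> nat)"
      and conv: "\<And>i. i \<in> ?I \<Longrightarrow> \<exists>l. (\<lambda>n. g (r n) i) \<longlonglongrightarrow> l"
      using function_convergent_subsequence[of ?I g, OF I g] by metis
    have "\<exists>l. (\<lambda>n. x (r n) j) \<longlonglongrightarrow> l" if "j \<in> {1..k}" for j
      using conv[OF UnI2[OF imageI[OF that]]] by (simp add: g_def)
    then obtain y where y: "\<And>j. j \<in> {1..k} \<Longrightarrow> (\<lambda>n. x (r n) j) \<longlonglongrightarrow> y j" by metis
    \<comment> \<open>This is the lower limit of the cells. By \<open>decided\<close> it is also the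
      upper limit, since a vertex outside it is eventually outside the cells.\<close>
    define Q where "Q j = {v \<in> V. \<forall>\<^sub>F n in sequentially. v \<in> P (r n) j}" for j
    have Q_sub: "Q j \<subseteq> V" for j by (auto simp: Q_def)
    have decided: "\<forall>\<^sub>F n in sequentially. v \<in> P (r n) j \<longleftrightarrow> v \<in> Q j"
      if vj: "v \<in> V" "j \<in> {1..k}" for v j
    proof -
      obtain l where "(\<lambda>n. of_bool (v \<in> P (r n) j) :: real) \<longlonglongrightarrow> l"
        using conv[of "Inl (v, j)"] vj by (auto simp: g_def)
      from convergent_of_bool[OF this] show ?thesis
      proof
        assume "\<forall>\<^sub>F n in sequentially. v \<in> P (r n) j"
        then show ?thesis using that by (auto simp: Q_def elim: eventually_mono)
      next
        assume ev: "\<forall>\<^sub>F n in sequentially. v \<notin> P (r n) j"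
        have "v \<notin> Q j"
        proof
          assume "v \<in> Q j"
          then have "\<forall>\<^sub>F n in sequentially. v \<in> P (r n) j" by (simp add: Q_def)
          with ev have "\<forall>\<^sub>F n in sequentially. False" by eventually_elim simp
          then show False by simp
        qed
        then show ?thesis using ev by (auto elim: eventually_mono)
      qed
    qed
    have Q_lim: "Q j \<noteq> {}" "lambda2B E \<nu> \<omega> (Q j) \<le> ennreal (y j)" if "j \<in> {1..k}" for j
    proof -
      note * = lambda2B_limit[OF fin C sob P_sub[OF that] P_con[OF that] Q_sub decided[OF _ that]
        eq_refl[OF lam[OF that]] y[OF that] x0]
      show "Q j \<noteq> {}" by (rule *)
      show "lambda2B E \<nu> \<omega> (Q j) \<le> ennreal (y j)" by (rule *)
    qed
    have Q_con: "induces_connected E (Q j)" if "j \<in> {1..k}" for j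
      using induces_connected_limit[OF no_loops _ P_sub[OF that] P_con[OF that] Q_sub
          Q_lim(1)[OF that] decided[OF _ that]] finite_paths by blast
    have "Q i \<inter> Q j = {}" if ij: "i \<in> {1..k}" "j \<in> {1..k}" "i \<noteq> j" for i j
    proof (rule ccontr)
      assume "Q i \<inter> Q j \<noteq> {}"
      then obtain v where "\<forall>\<^sub>F n in sequentially. v \<in> P (r n) i" "\<forall>\<^sub>F n in sequentially. v \<in> P (r n) j"
        by (auto simp: Q_def)
      then have "\<forall>\<^sub>F n in sequentially. False"
      proof eventually_elim
        case (elim n)
        then show False using disjoint_family_onD[OF P_disj ij] by blast
      qed
      then show False by simp
    qed
    then have "disjoint_family_on Q {1..k}" by (simp add: disjoint_family_on_def)
    moreover have "(\<Union>j\<in>{1..k}. Q j) = V"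
    proof (intro equalityI subsetI)
      fix v assume v: "v \<in> V"
      \<comment> \<open>There are only \<open>k\<close> cells, so one index settles all memberships
        of \<open>v\<close>, and the cell holding \<open>v\<close> at that index shows where
        \<open>v\<close> lies in the limit.\<close>
      have "\<forall>\<^sub>F n in sequentially. \<forall>j\<in>{1..k}. v \<in> P (r n) j \<longleftrightarrow> v \<in> Q j"
        using decided[OF v] by (intro eventually_ball_finite) auto
      then obtain n where "\<forall>j\<in>{1..k}. v \<in> P (r n) j \<longleftrightarrow> v \<in> Q j"
        by (auto simp: eventually_sequentially)
      then show "v \<in> (\<Union>j\<in>{1..k}. Q j)" using v P_un[of "r n"] by blast
    qed (use Q_sub in blast)
    ultimately have Q_CP: "Q \<in> ?CP"
      using Q_lim(1) Q_con by (simp add: connected_partitions_def k_partition_def)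
    \<comment> \<open>For \<open>j\<close> outside \<open>{1..k}\<close> the value
      \<open>y j\<close> is arbitrary; \<open>max 0\<close> supplies the nonnegativity that
      \<open>power_mean_limit\<close> asks of all indices and changes nothing for the cells.\<close>
    have "?\<Lambda> Q \<le> power_mean k p (\<lambda>j. ennreal (max 0 (y j)))"
      unfolding partition_energy_eq
    proof (rule power_mean_mono[OF k(1)])
      fix j assume "j \<in> {1..k}"
      from Q_lim(2)[OF this] show "lambda2B E \<nu> \<omega> (Q j) \<le> ennreal (max 0 (y j))"
        by (rule order_trans) (simp add: ennreal_leI)
    qed
    also have "\<dots> \<le> ennreal m"
    proof (rule power_mean_limit[OF k(1) p])
      show "(\<lambda>n. x (r n) j) \<longlonglongrightarrow> max 0 (y j)" if "j \<in> {1..k}" for j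
        using y[OF that] LIMSEQ_le_const[OF y[OF that], of 0] x0 by (simp add: max_absorb2)
      show "power_mean k p (\<lambda>j. ennreal (x (r n) j)) \<le> ennreal (b (r n))" for n
      proof -
        have "power_mean k p (\<lambda>j. ennreal (x (r n) j)) = ?\<Lambda> (P (r n))"
          unfolding partition_energy_eq by (rule power_mean_cong) (rule lam[symmetric])
        then show ?thesis using P(2)[of "r n"] by (simp add: less_imp_le)
      qed
      show "(\<lambda>n. b (r n)) \<longlonglongrightarrow> m" using LIMSEQ_subseq_LIMSEQ[OF b(1) r] by (simp add: o_def)
    qed (use x0 b(2) in auto)
    finally show ?thesis using Q_CP m(1) by auto
  qed
  then show ?thesis using L_le by (meson order_antisym)
qed

end
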